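(* Let $\alpha$ be a composition of $n$ and let $m_i$ be the number of parts of $\alpha$ equal to $i$ ($1\le i\le k$, where $k$ is the largest part). Then $$\Phi_\alpha=\binom{\ell(\alpha)}{m_1,m_2,\dots,m_k}^{-1}\sum_{\beta\succcurlyeq\alpha}|\mathrm{OSP}(\alpha,\beta)|\,M_\beta.$$
   Context: A composition of $n$ is a sequence of positive integers summing to $n$; $\ell(\alpha)$ is its number of parts. $\alpha\preccurlyeq\beta$ ($\beta\succcurlyeq\alpha$) means $\beta$ is obtained from $\alpha$ by summing consecutive blocks of parts; $\alpha^{(i)}$ is the block of parts of $\alpha$ summing to $\beta_i$. $M_\beta=\sum_{i_1<\cdots<i_r}x_{i_1}^{\beta_1}\cdots x_{i_r}^{\beta_r}$. $z_\alpha=\prod_i i^{m_i}m_i!$. For a composition $\gamma$, $\mathrm{sp}(\gamma)=\ell(\gamma)!\prod_j\gamma_j$, and for $\alpha\preccurlyeq\beta$, $\mathrm{sp}(\alpha,\beta)=\prod_{i}\mathrm{sp}(\alpha^{(i)})$. The type 2 quasisymmetric power sum is $\Phi_\alpha=z_\alpha\sum_{\beta\succcurlyeq\alpha}\frac{1}{\mathrm{sp}(\alpha,\beta)}M_\beta$. For $\alpha\preccurlyeq\beta$, $\mathrm{OSP}(\alpha,\beta)$ is the set of ordered set partitions $(B_1,\dots,B_{\ell(\beta)})$ of $\{1,\dots,\ell(\alpha)\}$ with $|B_i|=\ell(\alpha^{(i)})$; $\mathrm{OSP}(\alpha,\beta)=\emptyset$ if $\alpha\not\preccurlyeq\beta$.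 *)

theory Defs
  imports Complex_Main "HOL-Library.Poly_Mapping" "HOL-Library.Function_Algebras"
begin

definition composition_of :: "nat \<Rightarrow> nat list \<Rightarrow> bool" where
  "composition_of n \<alpha> \<longleftrightarrow> (\<forall>a\<in>set \<alpha>. 0 < a) \<and> sum_list \<alpha> = n"

definition is_blocks :: "nat list \<Rightarrow> nat list \<Rightarrow> nat list list \<Rightarrow> bool" where
  "is_blocks \<alpha> \<beta> \<gamma>s \<longleftrightarrow> concat \<gamma>s = \<alpha> \<and> [] \<notin> set \<gamma>s \<and> map sum_list \<gamma>s = \<beta>"

definition refines :: "nat list \<Rightarrow> nat list \<Rightarrow> bool"  (infix "\<preceq>\<^sub>c" 50) where
  "\<alpha> \<preceq>\<^sub>c \<beta> \<longleftrightarrow> (\<exists>\<gamma>s. is_blocks \<alpha> \<beta> \<gamma>s)"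

lemma is_blocks_unique:
  assumes "\<forall>a\<in>set \<alpha>. 0 < a" "is_blocks \<alpha> \<beta> \<gamma>s" "is_blocks \<alpha> \<beta> \<delta>s"
  shows "\<gamma>s = \<delta>s"
proof -
  have prefix_eq: "u = v"
    if "u @ r = v @ s" "sum_list u = sum_list v" "\<forall>a\<in>set (u @ r). 0 < a"
    for u v r s :: "nat list"
    using that
  proof (induction u arbitrary: v)
    case Nil
    then show ?case by (cases v) auto
  next
    case (Cons a u)
    then show ?case by (cases v) auto
  qed
  show ?thesis
    using assms
  proof (induction \<gamma>s arbitrary: \<alpha> \<beta> \<delta>s)
    case Nil
    then show ?case by (auto simp: is_blocks_def)
  next
    case (Cons u \<gamma>s)
    then obtain v \<delta>s' where d: "\<delta>s = v # \<delta>s'"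
      by (cases \<delta>s) (auto simp: is_blocks_def)
    with Cons.prems have "u @ concat \<gamma>s = v @ concat \<delta>s'" "sum_list u = sum_list v"
      and p: "\<forall>a\<in>set (u @ concat \<gamma>s). 0 < a"
      by (auto simp: is_blocks_def)
    then have "u = v" by (rule prefix_eq)
    moreover have "\<gamma>s = \<delta>s'"
      using Cons.prems p \<open>u = v\<close> d
      by (intro Cons.IH[of "concat \<gamma>s" "map sum_list \<gamma>s"]) (auto simp: is_blocks_def)
    ultimately show ?case using d by simp
  qed
qed

lemma finite_coarsenings: "finite {\<beta>. \<alpha> \<preceq>\<^sub>c \<beta>}"
proof -
  have len: "length \<gamma>s \<le> length (concat \<gamma>s)" if "[] \<notin> set \<gamma>s" for \<gamma>s :: "nat list list"
    using that
  proof (induction \<gamma>s)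
    case (Cons u \<gamma>s)
    then show ?case by (cases u) auto
  qed simp
  have sub: "set (map sum_list \<gamma>s) \<subseteq> {..sum_list (concat \<gamma>s)}" for \<gamma>s :: "nat list list"
    by (induction \<gamma>s) auto
  have "{\<beta>. \<alpha> \<preceq>\<^sub>c \<beta>} \<subseteq> {\<beta>. set \<beta> \<subseteq> {..sum_list \<alpha>} \<and> length \<beta> \<le> length \<alpha>}"
    using len sub unfolding refines_def is_blocks_def by fastforce
  then show ?thesis
    by (rule finite_subset) (simp add: finite_lists_length_le)
qed

(* The list of the \<alpha>^(i); meaningful only for a composition \<alpha> \<preceq>\<^sub>c \<beta>, where it is
   unique by is_blocks_unique. *)
definition blocks :: "nat list \<Rightarrow> nat list \<Rightarrow> nat list list" where
  "blocks \<alpha> \<beta> = (THE \<gamma>s. is_blocks \<alpha> \<beta> \<gamma>s)"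

definition z_comp :: "nat list \<Rightarrow> nat" where
  "z_comp \<alpha> = (\<Prod>i\<in>set \<alpha>. i ^ count_list \<alpha> i * fact (count_list \<alpha> i))"

definition sp :: "nat list \<Rightarrow> nat" where
  "sp \<gamma> = fact (length \<gamma>) * prod_list \<gamma>"

definition sp_pair :: "nat list \<Rightarrow> nat list \<Rightarrow> nat" where
  "sp_pair \<alpha> \<beta> = (\<Prod>\<gamma>\<leftarrow>blocks \<alpha> \<beta>. sp \<gamma>)"

(* Formal power series in the variables x_0, x_1, x_2, ..., given by their coefficients;
   a monomial is its finitely supported exponent vector, so a product of monomials is a sum
   of exponent vectors. Sums of power series are the pointwise ones of Function_Algebras;
   the pointwise product declared there is not the product of power series. *)
type_synonym 'a power_series = "(nat \<Rightarrow>\<^sub>0 nat) \<Rightarrow> 'a"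

definition scale :: "'a::semiring_1 \<Rightarrow> 'a power_series \<Rightarrow> 'a power_series"
    (infixr "*\<^sub>q" 75) where
  "c *\<^sub>q f = (\<lambda>m. c * f m)"

(* The coefficient of m is the number of index sequences i_1 < ... < i_r whose term
   x_{i_1}^{\<beta>_1} ... x_{i_r}^{\<beta>_r} equals m. For positive parts there is at most one. *)
definition M :: "nat list \<Rightarrow> 'a::semiring_1 power_series" where
  "M \<beta> = (\<lambda>m. of_nat (card {is. length is = length \<beta> \<and> sorted_wrt (<) is \<and>
                              sum_list (map2 Poly_Mapping.single is \<beta>) = m}))"

definition \<Phi> :: "nat list \<Rightarrow> 'a::field_char_0 power_series" where
  "\<Phi> \<alpha> = of_nat (z_comp \<alpha>) *\<^sub>q
           (\<Sum>\<beta> | \<alpha> \<preceq>\<^sub>c \<beta>. (1 / of_nat (sp_pair \<alpha> \<beta>)) *\<^sub>q M \<beta>)"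

definition ordered_set_partition :: "'b set \<Rightarrow> 'b set list \<Rightarrow> bool" where
  "ordered_set_partition A Bs \<longleftrightarrow>
     {} \<notin> set Bs \<and> \<Union>(set Bs) = A \<and>
     (\<forall>i<length Bs. \<forall>j<length Bs. i \<noteq> j \<longrightarrow> Bs ! i \<inter> Bs ! j = {})"

definition OSP :: "nat list \<Rightarrow> nat list \<Rightarrow> nat set list set" where
  "OSP \<alpha> \<beta> = (if \<alpha> \<preceq>\<^sub>c \<beta>
     then {Bs. ordered_set_partition {1..length \<alpha>} Bs \<and> length Bs = length \<beta> \<and>
               (\<forall>i<length \<beta>. card (Bs ! i) = length (blocks \<alpha> \<beta> ! i))}
     else {})"

definition multinomial :: "nat \<Rightarrow> nat list \<Rightarrow> 'a::field_char_0" where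
  "multinomial l ms = fact l / (\<Prod>m\<leftarrow>ms. fact m)"

(* 0 for the empty composition. *)
definition largest_part :: "nat list \<Rightarrow> nat" where
  "largest_part \<alpha> = Max (insert 0 (set \<alpha>))"

end

theory Submission
  imports Defs "HOL-Library.Multiset"
begin

text \<open>Both sides are combinations of the same \<open>M \<beta>\<close>, so it suffices to compare coefficients.
  If \<open>l\<close> is the length of \<open>\<alpha>\<close> and \<open>l\<^sub>1, l\<^sub>2, \<dots>\<close> are the lengths of the blocks, then
  \<open>|OSP(\<alpha>, \<beta>)| = l! / (l\<^sub>1! l\<^sub>2! \<dots>)\<close>. The products of the parts over all blocks multiply to the
  product \<open>\<Prod>i. i ^ m\<^sub>i\<close> of all parts of \<open>\<alpha>\<close>, which cancels against the same factor of
  \<open>z\<close>; what remains of \<open>z\<close> is \<open>\<Prod>i. m\<^sub>i!\<close>, and \<open>l!\<close> cancels against the multinomial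
  coefficient.\<close>

text \<open>Disjointness is symmetric, so index pairs with \<open>i < j\<close> suffice. The gain is
  that \<open>sorted_wrt\<close> unfolds along \<open>Cons\<close>, which yields the recursive rules
  for \<open>ordered_set_partition\<close> used in the count.\<close>

lemma ordered_set_partition_iff_sorted_wrt:
  "ordered_set_partition A Bs \<longleftrightarrow>
     {} \<notin> set Bs \<and> \<Union>(set Bs) = A \<and> sorted_wrt (\<lambda>X Y. X \<inter> Y = {}) Bs"
proof -
  have "(\<forall>i<length Bs. \<forall>j<length Bs. i \<noteq> j \<longrightarrow> Bs ! i \<inter> Bs ! j = {}) \<longleftrightarrow>
      (\<forall>i j. i < j \<longrightarrow> j < length Bs \<longrightarrow> Bs ! i \<inter> Bs ! j = {})"
    (is "?L \<longleftrightarrow> ?R")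
  proof
    show "?R" if "?L"
      using that by auto
    show "?L" if "?R"
    proof (intro allI impI)
      fix i j
      assume "i < length Bs" "j < length Bs" "i \<noteq> j"
      with that show "Bs ! i \<inter> Bs ! j = {}"
        by (cases i j rule: linorder_cases) (auto simp: Int_commute)
    qed
  qed
  then show ?thesis
    by (simp add: ordered_set_partition_def sorted_wrt_iff_nth_less)
qed

lemma ordered_set_partition_Nil [simp]: "ordered_set_partition A [] \<longleftrightarrow> A = {}"
  by (auto simp: ordered_set_partition_def)

lemma ordered_set_partition_Cons [simp]:
  "ordered_set_partition A (B # Bs) \<longleftrightarrow>
     B \<noteq> {} \<and> B \<subseteq> A \<and> ordered_set_partition (A - B) Bs"
  unfolding ordered_set_partition_iff_sorted_wrt by auto

text \<open>Induction on \<open>ks\<close>: choose the first block among the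
  \<open>k\<close>-subsets of \<open>A\<close>, then partition the rest, whose size does not depend
  on that choice. The multinomial formula is stated as a product to avoid division in
  \<open>nat\<close>; finiteness is carried along because counting the dependent pairs requires
  it.\<close>

lemma card_ordered_set_partitions:
  assumes "finite A" "sum_list ks = card A" "0 \<notin> set ks"
  shows "finite {Bs. ordered_set_partition A Bs \<and> map card Bs = ks} \<and>
    card {Bs. ordered_set_partition A Bs \<and> map card Bs = ks} * (\<Prod>k\<leftarrow>ks. fact k) = fact (card A)"
  using assms
proof (induction ks arbitrary: A)
  case Nil
  then have "{Bs. ordered_set_partition A Bs \<and> map card Bs = []} = {[]}"
    by auto
  with Nil show ?case by simp
next
  case (Cons k ks)
  let ?P = "\<lambda>A ks. {Bs. ordered_set_partition A Bs \<and> map card Bs = ks}"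
  let ?K = "{B. B \<subseteq> A \<and> card B = k}"
  have k: "0 < k" "k \<le> card A" "sum_list ks = card A - k"
    using Cons.prems by auto
  have IH: "finite (?P (A - B) ks)"
    "card (?P (A - B) ks) * (\<Prod>k\<leftarrow>ks. fact k) = fact (card A - k)" if "B \<in> ?K" for B
  proof -
    have "card (A - B) = card A - k"
      using that Cons.prems(1) by (auto simp: card_Diff_subset finite_subset)
    then show "finite (?P (A - B) ks)"
      "card (?P (A - B) ks) * (\<Prod>k\<leftarrow>ks. fact k) = fact (card A - k)"
      using Cons.IH[of "A - B"] Cons.prems k by auto
  qed
  have finK: "finite ?K"
    using Cons.prems(1) by simp
  \<comment> \<open>Here \<open>0 < k\<close> makes the condition \<open>B \<noteq> {}\<close>
    follow from \<open>card B = k\<close>.\<close>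
  have split: "?P A (k # ks) = (\<lambda>(B, Bs). B # Bs) ` (SIGMA B:?K. ?P (A - B) ks)"
    using k(1) by (auto simp: image_iff map_eq_Cons_conv)
  have "card (?P A (k # ks)) = (\<Sum>B\<in>?K. card (?P (A - B) ks))"
    unfolding split using finK IH(1)
    by (subst card_image) (auto simp: inj_on_def intro!: card_SigmaI)
  then have "card (?P A (k # ks)) * (\<Prod>k\<leftarrow>k # ks. fact k) =
      fact k * (\<Sum>B\<in>?K. card (?P (A - B) ks) * (\<Prod>k\<leftarrow>ks. fact k))"
    by (simp add: sum_distrib_left sum_distrib_right ac_simps)
  also have "\<dots> = fact k * fact (card A - k) * (card A choose k)"
    using IH(2) Cons.prems(1) by (simp add: n_subsets)
  also have "\<dots> = fact (card A)"
    using k(2) by (rule binomial_fact_lemma)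
  finally show ?case
    using split finK IH(1) by auto
qed

text \<open>Positivity of the parts makes the decomposition unique, so the description by
  \<open>THE\<close> is justified.\<close>

lemma is_blocks_blocks:
  assumes "\<forall>a\<in>set \<alpha>. 0 < a" "\<alpha> \<preceq>\<^sub>c \<beta>"
  shows "is_blocks \<alpha> \<beta> (blocks \<alpha> \<beta>)"
  unfolding blocks_def using assms is_blocks_unique
  by (metis refines_def theI)

text \<open>The block lengths sum to \<open>length \<alpha>\<close> because the blocks concatenate
  to \<open>\<alpha>\<close>, and none is zero because no block is empty; so the general count
  applies.\<close>

lemma card_OSP:
  assumes "\<forall>a\<in>set \<alpha>. 0 < a" "\<alpha> \<preceq>\<^sub>c \<beta>"
  shows "card (OSP \<alpha> \<beta>) * (\<Prod>\<gamma>\<leftarrow>blocks \<alpha> \<beta>. fact (length \<gamma>)) = fact (length \<alpha>)"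
proof -
  let ?ks = "map length (blocks \<alpha> \<beta>)"
  have blocks: "is_blocks \<alpha> \<beta> (blocks \<alpha> \<beta>)"
    using assms by (rule is_blocks_blocks)
  then have len: "length (blocks \<alpha> \<beta>) = length \<beta>"
    unfolding is_blocks_def by (metis length_map)
  have "map card Bs = ?ks \<longleftrightarrow> length Bs = length \<beta> \<and>
      (\<forall>i<length \<beta>. card (Bs ! i) = length (blocks \<alpha> \<beta> ! i))" for Bs :: "nat set list"
    unfolding list_eq_iff_nth_eq length_map len by (metis len nth_map)
  then have "OSP \<alpha> \<beta> = {Bs. ordered_set_partition {1..length \<alpha>} Bs \<and> map card Bs = ?ks}"
    unfolding OSP_def using assms(2) by presburger
  moreover have "sum_list ?ks = card {1..length \<alpha>}"
    using blocks by (metis card_atLeastAtMost diff_Suc_1 is_blocks_def length_concat)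
  moreover have "0 \<notin> set ?ks"
    using blocks by (auto simp: is_blocks_def)
  ultimately show ?thesis
    using card_ordered_set_partitions[of "{1..length \<alpha>}" ?ks] by (simp add: o_def)
qed

lemma prod_list_conv_prod_count_list:
  "prod_list xs = (\<Prod>x\<in>set xs. x ^ count_list xs x)"
  for xs :: "'a::comm_monoid_mult list"
  by (simp add: prod_mset_multiplicity count_mset flip: prod_mset_prod_list)

lemma prod_list_mult: "(\<Prod>x\<leftarrow>xs. f x * g x) = (\<Prod>x\<leftarrow>xs. f x) * (\<Prod>x\<leftarrow>xs. g x)"
  for f g :: "'b \<Rightarrow> 'a::comm_monoid_mult"
  by (induction xs) (simp_all add: ac_simps)

lemma z_comp_eq: "z_comp \<alpha> = prod_list \<alpha> * (\<Prod>i\<in>set \<alpha>. fact (count_list \<alpha> i))"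
  by (simp add: z_comp_def prod.distrib prod_list_conv_prod_count_list)

lemma prod_list_concat: "prod_list (concat xss) = (\<Prod>xs\<leftarrow>xss. prod_list xs)"
  for xss :: "'a::monoid_mult list list"
  by (induction xss) simp_all

text \<open>The parts of all blocks together are the parts of \<open>\<alpha>\<close>, so this
  factor is the same for every \<open>\<beta>\<close> and is the one split off in
  \<open>z_comp_eq\<close>.\<close>

lemma sp_pair_eq:
  assumes "\<forall>a\<in>set \<alpha>. 0 < a" "\<alpha> \<preceq>\<^sub>c \<beta>"
  shows "sp_pair \<alpha> \<beta> = (\<Prod>\<gamma>\<leftarrow>blocks \<alpha> \<beta>. fact (length \<gamma>)) * prod_list \<alpha>"
proof -
  have "prod_list \<alpha> = (\<Prod>\<gamma>\<leftarrow>blocks \<alpha> \<beta>. prod_list \<gamma>)"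
    using is_blocks_blocks[OF assms] by (metis is_blocks_def prod_list_concat)
  then show ?thesis
    by (simp add: sp_pair_def sp_def prod_list_mult)
qed

lemma z_comp_div_sp_pair:
  assumes "\<forall>a\<in>set \<alpha>. 0 < a" "\<alpha> \<preceq>\<^sub>c \<beta>"
  shows "of_nat (z_comp \<alpha>) / of_nat (sp_pair \<alpha> \<beta>) =
    (of_nat (\<Prod>i\<in>set \<alpha>. fact (count_list \<alpha> i)) / fact (length \<alpha>) * of_nat (card (OSP \<alpha> \<beta>))
      :: 'a::field_char_0)"
proof -
  let ?F = "\<Prod>\<gamma>\<leftarrow>blocks \<alpha> \<beta>. fact (length \<gamma>) :: nat"
  have "prod_list \<alpha> \<noteq> 0"
    using assms(1) by (auto simp: prod_list_zero_iff)
  moreover have "?F \<noteq> 0"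
    by (auto simp: prod_list_zero_iff)
  moreover have "(fact (length \<alpha>) :: 'a) = of_nat (card (OSP \<alpha> \<beta>)) * of_nat ?F"
    by (metis card_OSP[OF assms] of_nat_fact of_nat_mult)
  \<comment> \<open>The count divides a factorial, which is nonzero in characteristic 0. This
    permits cancelling it after \<open>fact (length \<alpha>)\<close> is replaced by the
    product.\<close>
  moreover from this have "of_nat (card (OSP \<alpha> \<beta>)) \<noteq> (0 :: 'a)"
    by (metis fact_nonzero mult_zero_left)
  ultimately show ?thesis
    unfolding z_comp_eq sp_pair_eq[OF assms] of_nat_mult
    by (simp add: divide_simps)
qed

lemma inverse_multinomial_counts:
  assumes "\<forall>a\<in>set \<alpha>. 0 < a"
    and "\<And>i. 1 \<le> i \<Longrightarrow> i \<le> largest_part \<alpha> \<Longrightarrow> m i = count_list \<alpha> i"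
  shows "inverse (multinomial (length \<alpha>) (map m [1..<Suc (largest_part \<alpha>)])) =
    (of_nat (\<Prod>i\<in>set \<alpha>. fact (count_list \<alpha> i)) / fact (length \<alpha>) :: 'a::field_char_0)"
proof -
  \<comment> \<open>The range starts at 1, so positivity of the parts is what places all of them in
    it.\<close>
  have sub: "set \<alpha> \<subseteq> {1..<Suc (largest_part \<alpha>)}"
    using assms(1) by (auto simp: largest_part_def Suc_le_eq less_Suc_eq_le)
  have "(\<Prod>x\<leftarrow>map m [1..<Suc (largest_part \<alpha>)]. fact x :: 'a) =
      (\<Prod>i\<in>{1..<Suc (largest_part \<alpha>)}. fact (m i))"
    by (simp add: prod.distinct_set_conv_list o_def del: upt_Suc flip: set_upt)
  also have "\<dots> = (\<Prod>i\<in>{1..<Suc (largest_part \<alpha>)}. fact (count_list \<alpha> i))"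
    using assms(2) by (intro prod.cong) auto
  \<comment> \<open>An index that is not a part of \<open>\<alpha>\<close> has count 0 and
    contributes \<open>fact 0 = 1\<close>.\<close>
  also have "\<dots> = (\<Prod>i\<in>set \<alpha>. fact (count_list \<alpha> i))"
    using sub by (intro prod.mono_neutral_right) (auto simp: count_list_0_iff)
  finally show ?thesis
    by (simp add: multinomial_def o_def del: upt_Suc)
qed

lemma sum_power_series_apply: "(\<Sum>x\<in>A. f x) p = (\<Sum>x\<in>A. f x p)"
  for f :: "'b \<Rightarrow> 'a::semiring_1 power_series"
  by (induction A rule: infinite_finite_induct) simp_all

theorem theorem3p21:
  fixes n :: nat and \<alpha> :: "nat list" and m :: "nat \<Rightarrow> nat" and k :: nat
  assumes "composition_of n \<alpha>"
    and "k = largest_part \<alpha>"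
    and "\<And>i. 1 \<le> i \<Longrightarrow> i \<le> k \<Longrightarrow> m i = count_list \<alpha> i"
  shows "(\<Phi> \<alpha> :: 'a::field_char_0 power_series) =
    inverse (multinomial (length \<alpha>) (map m [1..<Suc k])) *\<^sub>q
      (\<Sum>\<beta> | \<alpha> \<preceq>\<^sub>c \<beta>. of_nat (card (OSP \<alpha> \<beta>)) *\<^sub>q M \<beta>)"
proof
  fix p
  have pos: "\<forall>a\<in>set \<alpha>. 0 < a"
    using assms(1) by (simp add: composition_of_def)
  \<comment> \<open>The prefactor does not depend on \<open>\<beta>\<close>, so it can be moved in
    and out of the sum at each exponent vector \<open>p\<close>.\<close>
  define c :: 'a where "c = inverse (multinomial (length \<alpha>) (map m [1..<Suc k]))"
  have c: "c = of_nat (\<Prod>i\<in>set \<alpha>. fact (count_list \<alpha> i)) / fact (length \<alpha>)"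
    unfolding c_def assms(2) using assms by (intro inverse_multinomial_counts pos) auto
  have "\<Phi> \<alpha> p = (\<Sum>\<beta> | \<alpha> \<preceq>\<^sub>c \<beta>. of_nat (z_comp \<alpha>) / of_nat (sp_pair \<alpha> \<beta>) * M \<beta> p)"
    by (simp add: \<Phi>_def scale_def sum_power_series_apply sum_distrib_left)
  also have "\<dots> = (\<Sum>\<beta> | \<alpha> \<preceq>\<^sub>c \<beta>. c * (of_nat (card (OSP \<alpha> \<beta>)) * M \<beta> p))"
    unfolding c using pos by (intro sum.cong) (simp_all only: z_comp_div_sp_pair mem_Collect_eq mult.assoc)
  also have "\<dots> = (c *\<^sub>q (\<Sum>\<beta> | \<alpha> \<preceq>\<^sub>c \<beta>. of_nat (card (OSP \<alpha> \<beta>)) *\<^sub>q M \<beta>)) p"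
    by (simp add: scale_def sum_power_series_apply sum_distrib_left)
  finally show "(\<Phi> \<alpha> p :: 'a) = (inverse (multinomial (length \<alpha>) (map m [1..<Suc k])) *\<^sub>q
      (\<Sum>\<beta> | \<alpha> \<preceq>\<^sub>c \<beta>. of_nat (card (OSP \<alpha> \<beta>)) *\<^sub>q M \<beta>)) p"
    unfolding c_def .
qed

end
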